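(* Let $n\in\mathbb{N}$ and $\alpha,\gamma,\lambda\in\mathbb{C}$. Then $$ {}_5F_4\left(\begin{matrix}1+\alpha/2,\;(1+\alpha)/2,\;-n,\;1-\lambda+\alpha,\;\gamma+1\\2+\alpha,\;\Delta(2-\lambda+\alpha-n,2),\;\gamma\end{matrix}\right) =\frac{(\lambda)_n}{(\lambda-\alpha-n-1)(\lambda-\alpha)_{n-1}}\left(1+\frac{n(1+\alpha-\gamma)}{\lambda\gamma}\right). $$
   Context: ${}_pF_q$ denotes the generalized hypergeometric series evaluated at unit argument; $(a)_n=\Gamma(a+n)/\Gamma(a)$; $\Delta(a,2)=(a/2,(a+1)/2)$. Standing convention: lower parameters are never non-positive integers, and denominators occurring do not vanish. *)

theory Defs
  imports "HOL-Analysis.Analysis"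
begin

definition hypergeo_unit :: "complex list \<Rightarrow> complex list \<Rightarrow> complex" where
  "hypergeo_unit as bs = eval_fps (fps_hypergeo as bs 1) 1"

lemma hypergeo_unit_eq_suminf:
  "hypergeo_unit as bs =
     (\<Sum>k. prod_list (map (\<lambda>a. pochhammer a k) as) /
          (prod_list (map (\<lambda>b. pochhammer b k) bs) * fact k))"
proof -
  have "foldl (\<lambda>r a. r * pochhammer a k) c xs =
          c * prod_list (map (\<lambda>a. pochhammer a k) xs)" for c :: complex and xs k
    by (induction xs arbitrary: c) (simp_all add: mult.assoc)
  then show ?thesis
    by (simp add: hypergeo_unit_def eval_fps_def)
qed

(* (a)_k for an integer index k, since the index n - 1 is -1 when n = 0.  The literal quotient
   Gamma (a + k) / Gamma a would be wrong at the poles of Gamma, where HOL sets Gamma to 0;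
   the product form used here is its continuous extension. *)
definition poch_int :: "complex \<Rightarrow> int \<Rightarrow> complex" where
  "poch_int a k =
     (if k \<ge> 0 then pochhammer a (nat k) else 1 / pochhammer (a + of_int k) (nat (- k)))"

lemma poch_int_of_nat [simp]: "poch_int a (int n) = pochhammer a n"
  by (simp add: poch_int_def)

lemma poch_int_eq_Gamma:
  assumes "a \<notin> \<int>\<^sub>\<le>\<^sub>0" and "a + of_int k \<notin> \<int>\<^sub>\<le>\<^sub>0"
  shows "poch_int a k = Gamma (a + of_int k) / Gamma a"
proof (cases "k \<ge> 0")
  case True
  then show ?thesis
    using assms pochhammer_Gamma[of a "nat k"] by (simp add: poch_int_def)
next
  case False
  then show ?thesis
    using assms pochhammer_Gamma[of "a + of_int k" "nat (- k)"] by (simp add: poch_int_def)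
qed

definition Delta2 :: "complex \<Rightarrow> complex list" where
  "Delta2 a = [a / 2, (a + 1) / 2]"

end

theory Submission
  imports Defs
begin

text \<open>
  Put \<open>A\<^sub>n(x) = x (x+n+1)\<^sub>n\<^sub>-\<^sub>1\<close>. By the duplication formula, the \<open>k\<close>-th term of the
  series, multiplied by the denominator of the right-hand side, is
  \<open>(n choose k) A\<^sub>k(1+\<alpha>) A\<^sub>n\<^sub>-\<^sub>k(\<lambda>-\<alpha>-n-1) (1+k/\<gamma>)\<close>. So the theorem is a combination of the
  Rothe--Hagen convolution, which says that the \<open>A\<^sub>n\<close> are of binomial type, and of its version
  weighted by \<open>k\<close>. Both follow from a convolution of \<open>A\<^sub>n\<close> with \<open>P\<^sub>n(x) = (x+n+1)\<^sub>n\<close>, because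
  \<open>A\<^sub>n\<^sub>+\<^sub>1(x) = x P\<^sub>n(x+1)\<close>. That convolution holds because both families satisfy the difference
  equation \<open>f\<^sub>n(x+1) - f\<^sub>n(x) = n f\<^sub>n\<^sub>-\<^sub>1(x+2)\<close>.
\<close>

section \<open>Rothe-Hagen polynomials and their difference equations\<close>

text \<open>Divided by \<open>fact n\<close>, this is the Rothe-Hagen coefficient x/(x+2n)
  binom(x+2n, n) as a polynomial in \<open>x\<close>. At \<open>n = 0\<close> the index
  \<open>n - 1\<close> would truncate to 0; the value 1 stands for x (x+1)_{-1} = x/x.\<close>

definition rothe :: "nat \<Rightarrow> 'a::field_char_0 \<Rightarrow> 'a" where
  "rothe n x = (if n = 0 then 1 else x * pochhammer (x + of_nat n + 1) (n - 1))"

definition rothe_shift :: "nat \<Rightarrow> 'a::field_char_0 \<Rightarrow> 'a" where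
  "rothe_shift n x = pochhammer (x + of_nat n + 1) n"

lemma rothe_0 [simp]: "rothe 0 x = 1"
  by (simp add: rothe_def)

lemma rothe_shift_0 [simp]: "rothe_shift 0 x = 1"
  by (simp add: rothe_shift_def)

lemma rothe_Suc: "rothe (Suc n) x = x * rothe_shift n (x + 1)"
  by (simp add: rothe_def rothe_shift_def add_ac)

lemma rothe_at_0: "rothe n 0 = (if n = 0 then 1 else 0)"
  by (simp add: rothe_def)

text \<open>Both Pochhammer products contain \<open>?p\<close>; the linear factors left over,
  \<open>x + 2n + 3\<close> and \<open>x + n + 2\<close>, differ by \<open>n + 1\<close>.\<close>

lemma rothe_shift_diff:
  "rothe_shift (Suc n) (x + 1) - rothe_shift (Suc n) x = of_nat (Suc n) * rothe_shift n (x + 2)"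
proof -
  let ?p = "pochhammer (x + of_nat n + 3) n"
  have "rothe_shift (Suc n) (x + 1) = ?p * (x + 2 * of_nat n + 3)"
    by (simp add: rothe_shift_def pochhammer_Suc algebra_simps)
  moreover have "rothe_shift (Suc n) x = (x + of_nat n + 2) * ?p"
    by (simp add: rothe_shift_def pochhammer_rec algebra_simps)
  moreover have "rothe_shift n (x + 2) = ?p"
    by (simp add: rothe_shift_def algebra_simps)
  ultimately show ?thesis
    by (simp add: algebra_simps)
qed

text \<open>For \<open>n = m + 1\<close>, cancelling the common factor \<open>?p\<close> leaves
  \<open>(x+1)(x+2m+4) - x(x+m+3) = (m+2)(x+2)\<close>.\<close>

lemma rothe_diff: "rothe (Suc n) (x + 1) - rothe (Suc n) x = of_nat (Suc n) * rothe n (x + 2)"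
proof (cases n)
  case 0
  then show ?thesis by (simp add: rothe_Suc)
next
  case (Suc m)
  let ?p = "pochhammer (x + of_nat m + 4) m"
  have "rothe_shift (Suc m) (x + 2) = ?p * (x + 2 * of_nat m + 4)"
    by (simp add: rothe_shift_def pochhammer_Suc algebra_simps)
  moreover have "rothe_shift (Suc m) (x + 1) = (x + of_nat m + 3) * ?p"
    by (simp add: rothe_shift_def pochhammer_rec algebra_simps)
  moreover have "rothe_shift m (x + 3) = ?p"
    by (simp add: rothe_shift_def algebra_simps)
  ultimately show ?thesis
    unfolding Suc rothe_Suc by (simp add: algebra_simps)
qed

section \<open>Convolution identities\<close>

lemma poly_pochhammer_linear: "poly (pochhammer [:a, 1:] n) x = pochhammer (x + a) n"
  by (induction n) (simp_all add: pochhammer_Suc algebra_simps of_nat_poly)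

text \<open>Periodicity carries the zero at 0 to every natural number, and in characteristic 0 these
  are infinitely many roots.\<close>

lemma poly_eq_0_if_periodic:
  fixes p :: "'a::field_char_0 poly"
  assumes "\<And>x. poly p (x + 1) = poly p x" and "poly p 0 = 0"
  shows "p = 0"
proof (rule ccontr)
  assume "p \<noteq> 0"
  have "poly p (of_nat k) = 0" for k
    proof (induction k)
    case (Suc k)
    then show ?case
      using assms(1)[of "of_nat k"] by (simp add: add_ac)
  qed (simp add: assms(2))
  then have "range of_nat \<subseteq> {x. poly p x = 0}"
    by auto
  moreover have "infinite (range (of_nat :: nat \<Rightarrow> 'a))"
    by (simp add: finite_image_iff inj_of_nat)
  ultimately show False
    using poly_roots_finite[OF \<open>p \<noteq> 0\<close>] finite_subset by blast
qed

lemma sum_binomial_absorb: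
  fixes f :: "nat \<Rightarrow> 'a::comm_semiring_1"
  shows "(\<Sum>k\<le>Suc n. of_nat k * of_nat (Suc n choose k) * f k) =
           of_nat (Suc n) * (\<Sum>k\<le>n. of_nat (n choose k) * f (Suc k))"
proof -
  have "of_nat (Suc k) * of_nat (Suc n choose Suc k) * f (Suc k) =
          of_nat (Suc n) * (of_nat (n choose k) * f (Suc k))" for k
    unfolding mult.assoc[symmetric] of_nat_mult[symmetric] Suc_times_binomial ..
  then show ?thesis
    unfolding sum.atMost_Suc_shift by (simp del: of_nat_Suc binomial_Suc_Suc add: sum_distrib_left)
qed

lemma sum_binomial_reflect:
  fixes f g :: "nat \<Rightarrow> 'a::comm_semiring_1"
  shows "(\<Sum>k\<le>n. h (n - k) * of_nat (n choose k) * f k * g (n - k)) =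
           (\<Sum>k\<le>n. h k * of_nat (n choose k) * g k * f (n - k))"
  by (rule sum.reindex_bij_witness[where i = "\<lambda>k. n - k" and j = "\<lambda>k. n - k"])
     (auto simp: binomial_symmetric[symmetric] mult_ac)

text \<open>The difference of the two sides is a polynomial in \<open>y\<close>. By the difference
  equations and the induction hypothesis it has period 1, and it vanishes at
  \<open>y = 0\<close>.\<close>

lemma rothe_shift_convolution:
  fixes x y :: "'a::field_char_0"
  shows "(\<Sum>k\<le>n. of_nat (n choose k) * rothe k y * rothe_shift (n - k) x) = rothe_shift n (x + y)"
proof (induction n arbitrary: y)
  case 0
  then show ?case by simp
next
  case (Suc n)
  define f where "f = (\<lambda>y. (\<Sum>k\<le>Suc n. of_nat (Suc n choose k) * rothe k y *
    rothe_shift (Suc n - k) x) - rothe_shift (Suc n) (x + y))"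
  \<comment> \<open>\<open>rp k\<close> is \<open>rothe k\<close> as a formal polynomial, so that
    \<open>p\<close> is a polynomial with values \<open>f\<close>.\<close>
  define rp :: "nat \<Rightarrow> 'a poly" where
    "rp = (\<lambda>k. if k = 0 then 1 else [:0, 1:] * pochhammer [:of_nat k + 1, 1:] (k - 1))"
  define p where "p = (\<Sum>k\<le>Suc n. [:of_nat (Suc n choose k) * rothe_shift (Suc n - k) x:] * rp k) -
    pochhammer [:x + of_nat (Suc n) + 1, 1:] (Suc n)"
  have rp: "poly (rp k) y = rothe k y" for k y
    by (simp add: rp_def rothe_def poly_pochhammer_linear add_ac)
  have p: "poly p y = f y" for y
    unfolding p_def f_def poly_diff poly_sum poly_mult rp poly_pochhammer_linear rothe_shift_def
    by (simp add: algebra_simps del: sum.atMost_Suc binomial_Suc_Suc)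
  have "f (y + 1) = f y" for y
  proof -
    have *: "of_nat (Suc n choose k) * rothe k (y + 1) * c -
             of_nat (Suc n choose k) * rothe k y * c =
             of_nat k * of_nat (Suc n choose k) * (rothe (k - 1) (y + 2) * c)" for k c
    proof (cases k)
      case (Suc j)
      have "of_nat (Suc n choose k) * rothe k (y + 1) * c - of_nat (Suc n choose k) * rothe k y * c =
            of_nat (Suc n choose k) * (rothe k (y + 1) - rothe k y) * c"
        by (simp only: left_diff_distrib right_diff_distrib)
      then show ?thesis
        unfolding Suc rothe_diff by (simp only: diff_Suc_1 mult_ac)
    qed simp
    have "(\<Sum>k\<le>Suc n. of_nat (Suc n choose k) * rothe k (y + 1) * rothe_shift (Suc n - k) x) -
        (\<Sum>k\<le>Suc n. of_nat (Suc n choose k) * rothe k y * rothe_shift (Suc n - k) x) =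
        of_nat (Suc n) * (\<Sum>k\<le>n. of_nat (n choose k) * (rothe k (y + 2) * rothe_shift (n - k) x))"
      unfolding sum_subtractf[symmetric] * sum_binomial_absorb by simp
    \<comment> \<open>The difference equation shifts the argument by 2, which is why
      \<open>y\<close> is arbitrary in the induction.\<close>
    also have "\<dots> = of_nat (Suc n) * rothe_shift n (x + y + 2)"
      using Suc.IH[of "y + 2"] by (simp add: mult.assoc add.assoc)
    also have "\<dots> = rothe_shift (Suc n) (x + (y + 1)) - rothe_shift (Suc n) (x + y)"
      using rothe_shift_diff[of n "x + y"] by (simp add: add.assoc)
    finally show ?thesis
      by (simp add: f_def algebra_simps del: sum.atMost_Suc binomial_Suc_Suc)
  qed
  \<comment> \<open>At \<open>y = 0\<close> only the summand \<open>k = 0\<close> survives.\<close>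
  moreover have "f 0 = 0"
    unfolding f_def sum.atMost_Suc_shift by (simp add: rothe_at_0)
  ultimately have "p = 0"
    by (intro poly_eq_0_if_periodic) (simp_all add: p)
  then show ?case
    using p[of y] by (simp add: f_def del: sum.atMost_Suc binomial_Suc_Suc)
qed

text \<open>Absorbing the weight \<open>k\<close> into the binomial shifts the index, and
  \<open>rothe_Suc\<close> then splits off \<open>x\<close>. What remains is the previous
  convolution, summed in reverse order.\<close>

lemma rothe_convolution_weighted:
  fixes x y :: "'a::field_char_0"
  shows "(\<Sum>k\<le>Suc n. of_nat k * of_nat (Suc n choose k) * rothe k x * rothe (Suc n - k) y) =
           of_nat (Suc n) * x * rothe_shift n (x + y + 1)"
proof -
  have "(\<Sum>k\<le>n. of_nat (n choose k) * rothe_shift k (x + 1) * rothe (n - k) y) =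
        (\<Sum>k\<le>n. of_nat (n choose k) * rothe k y * rothe_shift (n - k) (x + 1))"
    using sum_binomial_reflect[of "\<lambda>_. 1"] by simp
  also have "\<dots> = rothe_shift n (x + y + 1)"
    unfolding rothe_shift_convolution by (simp add: add_ac)
  finally have eq: "(\<Sum>k\<le>n. of_nat (n choose k) * rothe_shift k (x + 1) * rothe (n - k) y) =
    rothe_shift n (x + y + 1)" .
  have "(\<Sum>k\<le>Suc n. of_nat k * of_nat (Suc n choose k) * (rothe k x * rothe (Suc n - k) y)) =
    of_nat (Suc n) * x * (\<Sum>k\<le>n. of_nat (n choose k) * rothe_shift k (x + 1) * rothe (n - k) y)"
    unfolding sum_binomial_absorb by (simp add: rothe_Suc sum_distrib_left mult_ac del: of_nat_Suc)
  then show ?thesis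
    unfolding eq by (simp only: mult.assoc)
qed

text \<open>The weights \<open>k\<close> and \<open>n - k\<close> add up to \<open>n\<close>, and
  each gives a weighted convolution; the factor \<open>n\<close> is then cancelled for
  \<open>n > 0\<close>.\<close>

lemma rothe_convolution:
  fixes x y :: "'a::field_char_0"
  shows "(\<Sum>k\<le>n. of_nat (n choose k) * rothe k x * rothe (n - k) y) = rothe n (x + y)"
proof (cases n)
  case (Suc m)
  let ?S = "\<lambda>w. \<Sum>k\<le>n. w k * of_nat (n choose k) * rothe k x * rothe (n - k) y"
  have "of_nat n * ?S (\<lambda>_. 1) = ?S of_nat + ?S (\<lambda>k. of_nat (n - k))"
    unfolding sum_distrib_left sum.distrib[symmetric]
    by (intro sum.cong) (auto simp: of_nat_diff algebra_simps)
  also have "?S of_nat = of_nat n * (x * rothe_shift m (x + y + 1))"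
    using rothe_convolution_weighted[of m x y] unfolding Suc by (simp only: mult.assoc)
  also have "?S (\<lambda>k. of_nat (n - k)) = of_nat n * (y * rothe_shift m (x + y + 1))"
    unfolding sum_binomial_reflect[of of_nat n "\<lambda>k. rothe k x" "\<lambda>k. rothe k y"]
    using rothe_convolution_weighted[of m y x] unfolding Suc by (simp only: mult.assoc add.commute)
  finally have "of_nat n * ?S (\<lambda>_. 1) = of_nat n * rothe n (x + y)"
    by (simp add: Suc rothe_Suc algebra_simps del: of_nat_Suc sum.atMost_Suc binomial_Suc_Suc)
  then show ?thesis
    using Suc by (simp del: of_nat_Suc sum.atMost_Suc binomial_Suc_Suc)
qed simp

section \<open>Pochhammer identities for the terms of the series\<close>

text \<open>With duplication, this reduces the upper parameters \<open>x/2\<close>,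
  \<open>(x+1)/2\<close> over the lower parameter \<open>x+1\<close> to \<open>rothe k x\<close>, up
  to a power of 4.\<close>

lemma pochhammer_even_eq_rothe:
  "pochhammer x (2 * k) = rothe k x * pochhammer (x + 1) k" for x :: "'a::field_char_0"
proof (cases k)
  case (Suc j)
  have "pochhammer x (2 * k) = x * pochhammer (x + 1) (k + j)"
    by (simp add: Suc pochhammer_rec[of x] mult_2)
  then show ?thesis
    unfolding pochhammer_product' by (simp add: Suc rothe_def add_ac)
qed simp

lemma pochhammer_reflect: "pochhammer (1 - b) k = (-1) ^ k * pochhammer (b - of_nat k) k"
  for b :: "'a::field_char_0"
  using pochhammer_minus[of "b - 1" k] by simp

text \<open>After reflection, the left side is \<open>y\<close> times the product from
  \<open>b - k\<close> to \<open>b + m - 1\<close>. Its last \<open>2k\<close> factors form the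
  Pochhammer symbol on the right; the others, with \<open>y\<close>, form the \<open>rothe\<close>
  factor.\<close>

lemma pochhammer_reflect_rothe:
  fixes b :: "'a::field_char_0"
  assumes "k \<le> Suc m"
  defines "y \<equiv> b - of_nat m - 2"
  shows "(-1) ^ k * pochhammer (1 - b) k * (y * pochhammer b m) =
           pochhammer (1 - b - of_nat m) (2 * k) * rothe (Suc m - k) y"
proof -
  have c: "pochhammer (1 - b - of_nat m) (2 * k) = pochhammer (b + of_nat m - 2 * of_nat k) (2 * k)"
    using pochhammer_reflect[of "b + of_nat m" "2 * k"] by (simp add: algebra_simps)
  have "(-1) ^ k * pochhammer (1 - b) k * pochhammer b m = pochhammer (b - of_nat k) (k + m)"
    unfolding pochhammer_product' pochhammer_reflect[of b k]
    by (simp add: mult.assoc[symmetric] flip: power_mult_distrib)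
  then have l: "(-1) ^ k * pochhammer (1 - b) k * (y * pochhammer b m) =
      y * pochhammer (b - of_nat k) (k + m)"
    by (simp add: mult_ac)
  show ?thesis
  proof (cases "k = Suc m")
    \<comment> \<open>Here the \<open>2k\<close> factors start one below \<open>b - k\<close>, at
      \<open>y\<close> itself, so \<open>y\<close> joins the product and
      \<open>rothe 0 y = 1\<close> is left.\<close>
    case True
    have "b + of_nat m - 2 * of_nat k = y" and "2 * k = Suc (k + m)" and yk: "y + 1 = b - of_nat k"
      by (simp_all add: True y_def algebra_simps)
    then have "pochhammer (b + of_nat m - 2 * of_nat k) (2 * k) = pochhammer y (Suc (k + m))"
      by (simp only:)
    also have "\<dots> = y * pochhammer (b - of_nat k) (k + m)"
      unfolding pochhammer_rec yk ..
    finally show ?thesis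
      using l c True by simp
  next
    case False
    with assms have k: "k \<le> m" by simp
    then have "pochhammer (b - of_nat k) (k + m) = pochhammer (b - of_nat k) ((m - k) + 2 * k)"
      by (simp add: mult_2 add.commute)
    also have "\<dots> = pochhammer (b - of_nat k) (m - k) * pochhammer (b + of_nat m - 2 * of_nat k) (2 * k)"
      unfolding pochhammer_product' using k by (simp add: of_nat_diff algebra_simps)
    finally have "pochhammer (b - of_nat k) (k + m) =
      pochhammer (b - of_nat k) (m - k) * pochhammer (b + of_nat m - 2 * of_nat k) (2 * k)" .
    moreover have "rothe (Suc m - k) y = y * pochhammer (b - of_nat k) (m - k)"
      using k by (simp add: rothe_def y_def Suc_diff_le of_nat_diff algebra_simps)
    ultimately show ?thesis
      unfolding l c by (simp add: mult_ac)
  qed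
qed

lemma pochhammer_neq_0: "pochhammer a k \<noteq> 0" if "a \<notin> \<int>\<^sub>\<le>\<^sub>0" for a :: "'a::field_char_0"
  using that by (auto simp: pochhammer_eq_0_iff)

lemma pochhammer_half_mult:
  "pochhammer (a / 2) k * pochhammer ((a + 1) / 2) k = pochhammer a (2 * k) / 4 ^ k"
  for a :: "'a::field_char_0"
  using pochhammer_double[of "a / 2" k] by (simp add: add_divide_distrib power_mult)

lemma pochhammer_neg_of_nat:
  "pochhammer (- of_nat n :: 'a::field_char_0) k = (-1) ^ k * fact k * of_nat (n choose k)"
  by (simp add: binomial_gbinomial gbinomial_pochhammer)

text \<open>Both sides are (a)_{k+1}/a. For \<open>a = \<gamma>\<close> this produces the linear
  weight in the series.\<close>

lemma pochhammer_add_1: "pochhammer (a + 1) k = (1 + of_nat k / a) * pochhammer a k"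
  if "a \<noteq> 0" for a :: "'a::field_char_0"
proof -
  have "a * pochhammer (a + 1) k = pochhammer a k * (a + of_nat k)"
    by (metis pochhammer_Suc pochhammer_rec)
  with that show ?thesis by (simp add: field_simps)
qed

section \<open>Summation of the terminating series\<close>

lemma hypergeo_unit_finite:
  assumes "- of_nat n \<in> set as"
  shows "hypergeo_unit as bs =
     (\<Sum>k\<le>n. prod_list (map (\<lambda>a. pochhammer a k) as) /
          (prod_list (map (\<lambda>b. pochhammer b k) bs) * fact k))"
proof -
  have "prod_list (map (\<lambda>a. pochhammer a k) as) = 0" if "k \<notin> {..n}" for k
    using assms that by (auto simp: prod_list_zero_iff pochhammer_of_nat_eq_0_iff image_iff
        intro!: bexI[of _ "- of_nat n"])
  then show ?thesis
    unfolding hypergeo_unit_eq_suminf by (intro suminf_finite) auto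
qed

theorem mainTheorem19:
  fixes n :: nat and \<alpha> \<gamma> lam :: complex
  assumes lower: "\<forall>b \<in> set ([2 + \<alpha>] @ Delta2 (2 - lam + \<alpha> - of_nat n) @ [\<gamma>]). b \<notin> \<int>\<^sub>\<le>\<^sub>0"
    and denom1: "(lam - \<alpha> - of_nat n - 1) * poch_int (lam - \<alpha>) (int n - 1) \<noteq> 0"
    and denom2: "lam * \<gamma> \<noteq> 0"
  shows "hypergeo_unit
           [1 + \<alpha> / 2, (1 + \<alpha>) / 2, - of_nat n, 1 - lam + \<alpha>, \<gamma> + 1]
           ([2 + \<alpha>] @ Delta2 (2 - lam + \<alpha> - of_nat n) @ [\<gamma>])
         = pochhammer lam n / ((lam - \<alpha> - of_nat n - 1) * poch_int (lam - \<alpha>) (int n - 1))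
           * (1 + of_nat n * (1 + \<alpha> - \<gamma>) / (lam * \<gamma>))"
proof (cases n)
  case 0
  \<comment> \<open>The index is -1, so \<open>poch_int\<close> gives the reciprocal of
    \<open>lam - \<alpha> - 1\<close>, which is nonzero by \<open>denom1\<close>.\<close>
  have "(lam - \<alpha> - of_nat n - 1) * poch_int (lam - \<alpha>) (int n - 1) = 1"
    using denom1 by (auto simp: 0 poch_int_def)
  then show ?thesis
    by (subst hypergeo_unit_finite[of n]) (simp_all add: 0 Delta2_def)
next
  case (Suc m)
  define x b c where "x = 1 + \<alpha>" and "b = lam - \<alpha>" and "c = 1 - b - of_nat m"
  \<comment> \<open>Since \<open>n = m + 1\<close>, this is the first factor of the denominator on
    the right-hand side, and \<open>D\<close> is the whole denominator.\<close>
  define y where "y = b - of_nat m - 2"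
  define D where "D = y * pochhammer b m"
  have D: "(lam - \<alpha> - of_nat n - 1) * poch_int (lam - \<alpha>) (int n - 1) = D"
    by (simp add: D_def y_def b_def Suc algebra_simps)
  have c: "2 - lam + \<alpha> - of_nat n = c" and xy: "x + y = lam - of_nat n"
    by (simp_all add: c_def y_def x_def b_def Suc)
  have D0: "D \<noteq> 0" and g0: "\<gamma> \<noteq> 0" and l0: "lam \<noteq> 0"
    using denom1 denom2 D by auto
  have nz: "x + 1 \<notin> \<int>\<^sub>\<le>\<^sub>0" "c / 2 \<notin> \<int>\<^sub>\<le>\<^sub>0" "(c + 1) / 2 \<notin> \<int>\<^sub>\<le>\<^sub>0" "\<gamma> \<notin> \<int>\<^sub>\<le>\<^sub>0"
    using lower unfolding c by (simp_all add: Delta2_def x_def add_ac)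
  have eqs: "1 + \<alpha> / 2 = (x + 1) / 2" "(1 + \<alpha>) / 2 = x / 2" "1 - lam + \<alpha> = 1 - b" "2 + \<alpha> = x + 1"
    by (simp_all add: x_def b_def field_simps)
  let ?r = "\<lambda>k. of_nat (n choose k) * rothe k x * rothe (n - k) y"
  have "pochhammer (1 + \<alpha> / 2) k * (pochhammer ((1 + \<alpha>) / 2) k * (pochhammer (- of_nat n) k *
      (pochhammer (1 - lam + \<alpha>) k * pochhammer (\<gamma> + 1) k))) /
      (pochhammer (2 + \<alpha>) k * (pochhammer (c / 2) k * (pochhammer ((c + 1) / 2) k *
      pochhammer \<gamma> k)) * fact k) = ?r k * (1 + of_nat k / \<gamma>) / D"
    (is "?lhs = _") if "k \<le> n" for k
  proof -
    have n0: "pochhammer (x + 1) k \<noteq> 0" "pochhammer \<gamma> k \<noteq> 0"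
        "pochhammer (c / 2) k * pochhammer ((c + 1) / 2) k \<noteq> 0"
      using nz by (simp_all add: pochhammer_neq_0)
    then have c0: "pochhammer c (2 * k) \<noteq> 0"
      by (simp add: pochhammer_half_mult)
    have "?lhs = (pochhammer (x / 2) k * pochhammer ((x + 1) / 2) k) * pochhammer (- of_nat n) k *
      pochhammer (1 - b) k * pochhammer (\<gamma> + 1) k /
      (pochhammer (x + 1) k * (pochhammer (c / 2) k * pochhammer ((c + 1) / 2) k) * pochhammer \<gamma> k * fact k)"
      unfolding eqs by (simp only: mult_ac)
    \<comment> \<open>The powers of 4 from the two duplications cancel; (-n)_k / k! supplies the
      binomial and the sign.\<close>
    also have "\<dots> = of_nat (n choose k) * rothe k x * (1 + of_nat k / \<gamma>) *
        ((-1) ^ k * pochhammer (1 - b) k / pochhammer c (2 * k))"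
      unfolding pochhammer_half_mult pochhammer_even_eq_rothe[of x] pochhammer_neg_of_nat
        pochhammer_add_1[OF g0]
      using n0 by simp
    also have "(-1) ^ k * pochhammer (1 - b) k / pochhammer c (2 * k) = rothe (n - k) y / D"
      using pochhammer_reflect_rothe[of k m b] that c0 D0
      unfolding Suc c_def[symmetric] y_def[symmetric] D_def[symmetric]
      by (simp add: field_simps)
    finally show ?thesis by simp
  qed
  then have "hypergeo_unit [1 + \<alpha> / 2, (1 + \<alpha>) / 2, - of_nat n, 1 - lam + \<alpha>, \<gamma> + 1]
      ([2 + \<alpha>] @ Delta2 c @ [\<gamma>]) = (\<Sum>k\<le>n. ?r k * (1 + of_nat k / \<gamma>) / D)"
    by (subst hypergeo_unit_finite[of n]) (simp_all add: Delta2_def)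
  also have "\<dots> = ((\<Sum>k\<le>n. ?r k) + (\<Sum>k\<le>n. of_nat k * ?r k) / \<gamma>) / D"
    unfolding sum_divide_distrib sum.distrib[symmetric]
    by (intro sum.cong) (simp_all add: add_divide_distrib algebra_simps)
  \<comment> \<open>As \<open>x + y + 1 = lam - m\<close>, the shift in \<open>rothe_shift m\<close>
    restores the base \<open>lam + 1\<close>; in the unweighted sum \<open>rothe n (lam - n)\<close>
    does the same.\<close>
  also have "(\<Sum>k\<le>n. of_nat k * ?r k) = of_nat n * x * pochhammer (lam + 1) m"
    using rothe_convolution_weighted[of m x y] unfolding Suc[symmetric] xy
    by (simp add: rothe_shift_def Suc mult.assoc del: sum.atMost_Suc)
  also have "(\<Sum>k\<le>n. ?r k) = (lam - of_nat n) * pochhammer (lam + 1) m"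
    unfolding rothe_convolution xy by (simp add: rothe_def Suc)
  \<comment> \<open>Without the common factor (lam+1)_m / D, this is
    \<open>lam - n + n x/\<gamma> = lam + n (x - \<gamma>)/\<gamma>\<close>.\<close>
  also have "((lam - of_nat n) * pochhammer (lam + 1) m + of_nat n * x * pochhammer (lam + 1) m / \<gamma>) / D
      = pochhammer lam n / D * (1 + of_nat n * (1 + \<alpha> - \<gamma>) / (lam * \<gamma>))"
    unfolding Suc pochhammer_rec x_def[symmetric] using D0 g0 l0 by (simp add: field_simps)
  finally show ?thesis
    unfolding c D .
qed

end
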